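(* Let the 4-star be the graph on vertices $s_1,s_2,s_3,s_4$ with edges $s_1s_2$, $s_2s_3$, $s_2s_4$ (so $s_2$ is the center). Let $H$ be the $(s_1,2)$-ordering of the 4-star. Then $R_<(H)=6$.
   Context: A $k$-ordering of a graph $H$ assigns distinct order-labels from $\{1,\ldots,|H|\}$ to $k$ of the vertices of $H$. For a vertex $v$ of $H$ and $1\le l\le |H|$, the $(v,l)$-ordering of $H$ is the 1-ordering in which $v$ receives order-label $l$ and no other vertex is labeled. An ordered 2-coloring on $n$ vertices is a red/blue coloring of the edges of the complete graph on vertex set $\{1,\ldots,n\}$. It contains a $k$-ordering $H$ (in a given color) if it has a subgraph isomorphic to $H$, all of whose edges have that color, such that for every $i$ the $i$-th smallest vertex of the copy corresponds to a vertex of $H$ that has order-label $i$ or no order-label. $R_<(H)$ is the least $n$ such that every ordered 2-coloring on $n$ vertices contains a monochromatic (red or blue) copy of $H$. *)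

theory Defs
  imports "HOL-Library.Ramsey"
begin

record 'a graph =
  verts :: "'a set"
  edges :: "'a set set"

definition simple_graph :: "('a, 'm) graph_scheme \<Rightarrow> bool" where
  "simple_graph G \<longleftrightarrow> finite (verts G) \<and> edges G \<subseteq> [verts G]\<^bsup>2\<^esup>"

definition complete_graph :: "'a set \<Rightarrow> 'a graph" where
  "complete_graph V = \<lparr>verts = V, edges = [V]\<^bsup>2\<^esup>\<rparr>"

definition subgraph :: "'a graph \<Rightarrow> 'a graph \<Rightarrow> bool" where
  "subgraph S G \<longleftrightarrow> simple_graph S \<and> verts S \<subseteq> verts G \<and> edges S \<subseteq> edges G"

definition graph_iso :: "('a \<Rightarrow> 'b) \<Rightarrow> ('a, 'm) graph_scheme \<Rightarrow> ('b, 'n) graph_scheme \<Rightarrow> bool" where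
  "graph_iso f G H \<longleftrightarrow> bij_betw f (verts G) (verts H) \<and> edges H = (\<lambda>e. f ` e) ` edges G"

text \<open>A partially ordered graph is a graph with a partial assignment of order-labels;
  \<open>None\<close> means that the vertex is unlabeled.\<close>

record 'a labeled_graph = "'a graph" +
  label :: "'a \<Rightarrow> nat option"

definition k_ordering :: "nat \<Rightarrow> 'a labeled_graph \<Rightarrow> bool" where
  "k_ordering k H \<longleftrightarrow>
     simple_graph H \<and> dom (label H) \<subseteq> verts H \<and> card (dom (label H)) = k \<and>
     inj_on (label H) (dom (label H)) \<and> ran (label H) \<subseteq> {1..card (verts H)}"

definition vl_ordering :: "'a graph \<Rightarrow> 'a \<Rightarrow> nat \<Rightarrow> 'a labeled_graph" where
  "vl_ordering G v l = \<lparr>verts = verts G, edges = edges G, label = [v \<mapsto> l]\<rparr>"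

lemma k_ordering_vl_ordering:
  assumes "simple_graph G" "v \<in> verts G" "1 \<le> l" "l \<le> card (verts G)"
  shows "k_ordering 1 (vl_ordering G v l)"
  using assms by (auto simp: k_ordering_def vl_ordering_def simple_graph_def)

datatype color = Red | Blue

text \<open>An ordered 2-coloring on \<open>n\<close> vertices is a function \<open>c\<close> on edges, of which only the values
  on the edges of the complete graph on \<open>{1..n}\<close> are used. List positions start at 0, so
  \<open>sorted_list_of_set (verts S) ! (i - 1)\<close> is the \<open>i\<close>-th smallest vertex of the copy \<open>S\<close>.\<close>

definition contains_in_color ::
  "nat \<Rightarrow> (nat set \<Rightarrow> color) \<Rightarrow> color \<Rightarrow> 'a labeled_graph \<Rightarrow> bool" where
  "contains_in_color n c col H \<longleftrightarrow>
     (\<exists>S f. subgraph S (complete_graph {1..n}) \<and> graph_iso f H S \<and>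
        (\<forall>e\<in>edges S. c e = col) \<and>
        (\<forall>i\<in>{1..card (verts H)}. \<forall>v\<in>verts H.
           f v = sorted_list_of_set (verts S) ! (i - 1) \<longrightarrow>
           label H v = Some i \<or> label H v = None))"

definition ordered_ramsey :: "'a labeled_graph \<Rightarrow> nat" where
  "ordered_ramsey H =
     (LEAST n. \<forall>c. contains_in_color n c Red H \<or> contains_in_color n c Blue H)"

datatype star_vertex = S1 | S2 | S3 | S4

definition star4 :: "star_vertex graph" where
  "star4 = \<lparr>verts = {S1, S2, S3, S4}, edges = {{S1, S2}, {S2, S3}, {S2, S4}}\<rparr>"

lemma simple_graph_star4: "simple_graph star4"
  by (auto simp: simple_graph_def star4_def nsets_def)

end

theory Submission
  imports Defs
begin

text \<open>If the center of a star is the smallest vertex of the copy, then the second smallest vertex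
  is a leaf, as the label on \<open>S1\<close> demands. So the pigeonhole principle at vertex \<open>1\<close>, which has five
  larger neighbors when \<open>n = 6\<close>, gives the upper bound. For the lower bound, the five-cycle and its
  complement (again a five-cycle) color \<open>K\<^sub>5\<close> with no vertex of degree three in either color.\<close>

lemma contains_star4_if_center_least:
  fixes x p q r n :: nat
  assumes "x < p" "p < q" "q < r" "1 \<le> x" "r \<le> n"
    and "c {x, p} = col" "c {x, q} = col" "c {x, r} = col"
  shows "contains_in_color n c col (vl_ordering star4 S1 2)"
proof -
  define S :: "nat graph" where "S = \<lparr>verts = {x, p, q, r}, edges = {{x, p}, {x, q}, {x, r}}\<rparr>"
  \<comment> \<open>The center \<open>S2\<close> goes to the least vertex \<open>x\<close>. The
    labeled leaf \<open>S1\<close> goes to \<open>p\<close>, which is then second smallest, as its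
    label requires.\<close>
  define f where "f v = (case v of S1 \<Rightarrow> p | S2 \<Rightarrow> x | S3 \<Rightarrow> q | S4 \<Rightarrow> r)" for v
  have "subgraph S (complete_graph {1..n})"
    using assms by (auto simp: S_def subgraph_def simple_graph_def complete_graph_def nsets_def)
  moreover have "graph_iso f (vl_ordering star4 S1 2) S"
    using assms
    by (auto simp: graph_iso_def bij_betw_def inj_on_def S_def vl_ordering_def star4_def f_def
        insert_commute)
  moreover have "\<forall>e\<in>edges S. c e = col"
    using assms by (auto simp: S_def)
  \<comment> \<open>With the list explicit, \<open>p\<close> has index \<open>1\<close>, which is
    \<open>i - 1\<close> for \<open>i = 2\<close>. Only \<open>S1\<close> carries a label, so this
    is the one position that matters.\<close>
  moreover have "sorted_list_of_set (verts S) = [x, p, q, r]"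
    using assms by (auto simp: S_def)
  then have "\<forall>i\<in>{1..card (verts (vl_ordering star4 S1 2))}. \<forall>v\<in>verts (vl_ordering star4 S1 2).
      f v = sorted_list_of_set (verts S) ! (i - 1) \<longrightarrow>
      label (vl_ordering star4 S1 2) v = Some i \<or> label (vl_ordering star4 S1 2) v = None"
    using assms
    by (auto simp: vl_ordering_def star4_def f_def nth_Cons' split: if_splits)
  ultimately show ?thesis
    unfolding contains_in_color_def by blast
qed

lemma contains_star4_on_six:
  "contains_in_color 6 c Red (vl_ordering star4 S1 2) \<or>
   contains_in_color 6 c Blue (vl_ordering star4 S1 2)"
proof -
  \<comment> \<open>Drawing the neighbors from \<open>{2..6}\<close> puts the center
    \<open>1\<close> below any three of them.\<close>
  let ?N = "\<lambda>col. {y \<in> {2..6::nat}. c {1, y} = col}"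
  have "contains_in_color 6 c col (vl_ordering star4 S1 2)" if big: "3 \<le> card (?N col)" for col
  proof -
    obtain U where U: "U \<subseteq> ?N col" "card U = 3" "finite U"
      using obtain_subset_with_card_n[OF big] by metis
    have "length (sorted_list_of_set U) = 3"
      using U by simp
    then obtain p q r where pqr: "sorted_list_of_set U = [p, q, r]"
      by (auto simp: numeral_3_eq_3 length_Suc_conv simp del: length_sorted_list_of_set)
    have "p < q" "q < r"
      using strict_sorted_list_of_set[of U] pqr by auto
    moreover have "{p, q, r} \<subseteq> ?N col"
      using U set_sorted_list_of_set[of U] pqr by simp
    ultimately show ?thesis
      by (intro contains_star4_if_center_least[of 1 p q r]) auto
  qed
  moreover have "3 \<le> card (?N Red) \<or> 3 \<le> card (?N Blue)"
  proof -
    have "?N Red \<union> ?N Blue = {2..6}"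
      using color.nchotomy by blast
    then have "5 \<le> card (?N Red) + card (?N Blue)"
      using card_Un_le[of "?N Red" "?N Blue"] by simp
    then show ?thesis by linarith
  qed
  ultimately show ?thesis by blast
qed

text \<open>The order condition is dropped and only the image of the underlying star is kept. The
  lower bound thereby becomes a question about degrees, whatever the label \<open>l\<close>.\<close>

lemma contains_star4_imp_degree_three:
  assumes "contains_in_color n c col (vl_ordering star4 S1 l)"
  obtains x p q r where "{x, p, q, r} \<subseteq> {1..n}" "distinct [x, p, q, r]"
    "c {x, p} = col" "c {x, q} = col" "c {x, r} = col"
proof -
  obtain S f where S: "subgraph S (complete_graph {1..n})"
    "graph_iso f (vl_ordering star4 S1 l) S" "\<forall>e\<in>edges S. c e = col"
    using assms unfolding contains_in_color_def by blast
  have "inj_on f {S1, S2, S3, S4}" "f ` {S1, S2, S3, S4} = verts S"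
    and "edges S = {{f S2, f S1}, {f S2, f S3}, {f S2, f S4}}"
    using S(2) by (auto simp: graph_iso_def bij_betw_def vl_ordering_def star4_def insert_commute)
  then show thesis
    using S(1,3) by (intro that[of "f S2" "f S1" "f S3" "f S4"])
      (auto simp: subgraph_def complete_graph_def inj_on_def)
qed

definition pentagon :: "nat set \<Rightarrow> color" where
  "pentagon e = (if e \<in> {{1, 2}, {2, 3}, {3, 4}, {4, 5}, {5, 1}} then Red else Blue)"

text \<open>Each color class is a five-cycle, hence 2-regular. Naming two vertices \<open>p\<close>
  and \<open>q\<close> that cover the neighbors expresses the degree bound without
  cardinalities.\<close>

lemma pentagon_degree_le_two:
  assumes "x \<in> {1..5}"
  obtains p q where "\<And>y. y \<in> {1..5} \<Longrightarrow> y \<noteq> x \<Longrightarrow> pentagon {x, y} = col \<Longrightarrow> y \<in> {p, q}"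
proof -
  have range: "{1..5} = {1, 2, 3, 4, 5 :: nat}" by auto
  have "\<exists>p q. \<forall>y\<in>{1..5}. y \<noteq> x \<longrightarrow> pentagon {x, y} = col \<longrightarrow> y \<in> {p, q}"
  proof (cases col)
    case Red
    \<comment> \<open>The successor and predecessor of \<open>x\<close> on the cycle, wrapping
      around at \<open>5\<close> and \<open>1\<close>.\<close>
    have "\<forall>y\<in>{1..5}. y \<noteq> x \<longrightarrow> pentagon {x, y} = Red \<longrightarrow>
      y \<in> {if x = 5 then 1 else x + 1, if x = 1 then 5 else x - 1}"
      using assms unfolding range by (auto simp: pentagon_def doubleton_eq_iff)
    with Red show ?thesis by blast
  next
    case Blue
    \<comment> \<open>The vertices at cyclic distance two: \<open>x + 2\<close> and
      \<open>x + 3\<close> modulo 5, with representatives in \<open>{1..5}\<close>.\<close>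
    have "\<forall>y\<in>{1..5}. y \<noteq> x \<longrightarrow> pentagon {x, y} = Blue \<longrightarrow>
      y \<in> {if x \<le> 3 then x + 2 else x - 3, if x \<le> 2 then x + 3 else x - 2}"
      using assms unfolding range by (auto simp: pentagon_def doubleton_eq_iff)
    with Blue show ?thesis by blast
  qed
  then show thesis using that by blast
qed

lemma pentagon_avoids_star4:
  assumes "n \<le> 5"
  shows "\<not> contains_in_color n pentagon col (vl_ordering star4 S1 l)"
proof
  assume "contains_in_color n pentagon col (vl_ordering star4 S1 l)"
  then obtain x a b d where star: "{x, a, b, d} \<subseteq> {1..n}" "distinct [x, a, b, d]"
    "pentagon {x, a} = col" "pentagon {x, b} = col" "pentagon {x, d} = col"
    by (rule contains_star4_imp_degree_three)
  \<comment> \<open>A copy inside \<open>{1..n}\<close> also lies in \<open>{1..5}\<close>, so a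
    single coloring settles all \<open>n \<le> 5\<close> at once.\<close>
  have sub: "{x, a, b, d} \<subseteq> {1..5}"
    using star(1) assms by auto
  then obtain p q where
    "\<And>y. y \<in> {1..5} \<Longrightarrow> y \<noteq> x \<Longrightarrow> pentagon {x, y} = col \<Longrightarrow> y \<in> {p, q}"
    using pentagon_degree_le_two[of x col] by blast
  then have "{a, b, d} \<subseteq> {p, q}"
    using star sub by auto
  then show False
    using star(2) by auto
qed

theorem theorem3p3:
  shows "ordered_ramsey (vl_ordering star4 S1 2) = 6"
  unfolding ordered_ramsey_def
proof (rule Least_equality)
  show "\<forall>c. contains_in_color 6 c Red (vl_ordering star4 S1 2) \<or>
      contains_in_color 6 c Blue (vl_ordering star4 S1 2)"
    using contains_star4_on_six by blast
next
  fix n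
  assume "\<forall>c. contains_in_color n c Red (vl_ordering star4 S1 2) \<or>
      contains_in_color n c Blue (vl_ordering star4 S1 2)"
  then have "\<not> n \<le> 5"
    using pentagon_avoids_star4 by blast
  then show "6 \<le> n" by simp
qed

end
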